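(* For each odd positive integer $m$ and each nonnegative integer $\Delta\le \frac{m+1}{2}$, there is a digraph $G$ of order $(2m+1)(\Delta+1)$ with strong components $G_1,G_2,\ldots,G_{\Delta+1}$ and with $\Delta=\Delta^+(\mathrm{SC}(G))$, such that $$\zeta(G)=\max_{1\le i\le \Delta+1}\zeta(G_i)+\Delta.$$
   Context: All digraphs are finite, nonempty, simple and oriented (no loops, at most one arc between any two distinct vertices), and need not be strongly connected. The strong components of $G$ are its maximal strongly connected subdigraphs. The strong component digraph $\mathrm{SC}(G)$ is obtained from $G$ by contracting each strong component to a single vertex and deleting resulting loops and parallel arcs: its vertices are the strong components, with an arc from $G_i$ to $G_j$ ($i\ne j$) if some arc of $G$ goes from a vertex of $G_i$ to a vertex of $G_j$. $\Delta^+(H)$ is the maximum out-degree of a digraph $H$. $d(u,v)$ is the length of a shortest directed path from $u$ to $v$, and $d(u,v)=\infty$ if there is no such path. The Localization game with $k$ cops on $G$: an invisible robber first chooses a vertex; in each round the cops choose vertices $u_1,\dots,u_k$ (any vertices, chosen afresh each round) and learn the distance vector $(d(u_1,x),\ldots,d(u_k,x))$, where $x$ is the robber's current vertex; then the robber stays at $x$ or moves along an arc $(x,y)$ to an out-neighbor $y$. The cops win if they have a strategy which, whatever the robber does, after finitely many rounds determines a unique possible vertex for the robber right after a probe (using all information received so far); otherwise the robber wins. The localization number $\zeta(G)$ is the least positive integer $k$ for which $k$ cops have a winning strategy. *)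

theory Defs
  imports "Graph_Theory.Graph_Theory"
begin

locale oriented_digraph = digraph +
  assumes verts_nonempty: "verts G \<noteq> {}"
    and no_antiparallel: "u \<rightarrow> v \<Longrightarrow> \<not> v \<rightarrow> u"

text \<open>Distance is the weighted distance of the library for unit arc costs.\<close>

definition ddist :: "('a, 'b) pre_digraph \<Rightarrow> 'a \<Rightarrow> 'a \<Rightarrow> ereal" where
  "ddist G u v = wf_digraph.\<mu> G (\<lambda>_. 1) u v"

lemma (in wf_digraph) ddist_eq_INF_length:
  "ddist G u v = (INF p\<in>{p. awalk u p v}. ereal (real (length p)))"
proof -
  have "awalk_cost (\<lambda>_. 1) p = real (length p)" for p :: "'b list"
    by (induction p) (simp_all add: awalk_cost_def)
  then show ?thesis
    by (simp add: ddist_def \<mu>_def)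
qed


definition max_out_degree :: "('a, 'b) pre_digraph \<Rightarrow> nat" where
  "max_out_degree H = Max (out_degree H ` verts H)"

definition SC :: "('a, 'b) pre_digraph \<Rightarrow> ('a, 'b) pre_digraph pair_pre_digraph" where
  "SC G = \<lparr> pverts = pre_digraph.sccs G,
            parcs = {(H, K). H \<in> pre_digraph.sccs G \<and> K \<in> pre_digraph.sccs G \<and> H \<noteq> K
                       \<and> (\<exists>u \<in> verts H. \<exists>v \<in> verts K. u \<rightarrow>\<^bsub>G\<^esub> v)} \<rparr>"


section \<open>The Localization game\<close>

text \<open>
  A play of the robber is the sequence of its positions, one for each probe. A strategy of the cops
  maps the list of distance vectors learned so far, oldest first, to the next vertices to probe;
  the earlier probes are themselves determined by this list.
\<close>

type_synonym 'a cop_strategy = "ereal list list \<Rightarrow> 'a list"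

definition robber_play :: "('a, 'b) pre_digraph \<Rightarrow> (nat \<Rightarrow> 'a) \<Rightarrow> bool" where
  "robber_play G x \<longleftrightarrow>
     x 0 \<in> verts G \<and> (\<forall>t. x (Suc t) = x t \<or> x t \<rightarrow>\<^bsub>G\<^esub> x (Suc t))"

definition cop_strategy :: "('a, 'b) pre_digraph \<Rightarrow> nat \<Rightarrow> 'a cop_strategy \<Rightarrow> bool" where
  "cop_strategy G k \<sigma> \<longleftrightarrow> (\<forall>h. length (\<sigma> h) = k \<and> set (\<sigma> h) \<subseteq> verts G)"

primrec answers ::
  "('a, 'b) pre_digraph \<Rightarrow> 'a cop_strategy \<Rightarrow> (nat \<Rightarrow> 'a) \<Rightarrow> nat \<Rightarrow> ereal list list" where
  "answers G \<sigma> x 0 = []"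
| "answers G \<sigma> x (Suc n) =
     answers G \<sigma> x n @ [map (\<lambda>u. ddist G u (x n)) (\<sigma> (answers G \<sigma> x n))]"

text \<open>The positions that the cops cannot rule out right after the probe of round \<open>n\<close>.\<close>

definition possible_positions ::
  "('a, 'b) pre_digraph \<Rightarrow> 'a cop_strategy \<Rightarrow> (nat \<Rightarrow> 'a) \<Rightarrow> nat \<Rightarrow> 'a set" where
  "possible_positions G \<sigma> x n =
     {y n | y. robber_play G y \<and> answers G \<sigma> y (Suc n) = answers G \<sigma> x (Suc n)}"

definition cops_win :: "('a, 'b) pre_digraph \<Rightarrow> nat \<Rightarrow> bool" where
  "cops_win G k \<longleftrightarrow>
     (\<exists>\<sigma>. cop_strategy G k \<sigma> \<and>
        (\<forall>x. robber_play G x \<longrightarrow> (\<exists>n v. possible_positions G \<sigma> x n = {v})))"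

definition localization_number :: "('a, 'b) pre_digraph \<Rightarrow> nat" (\<open>\<zeta>\<close>) where
  "\<zeta> G = (LEAST k. 0 < k \<and> cops_win G k)"

end

theory Submission
  imports Defs
begin

text \<open>
  Let \<open>n = 2 * m + 1\<close> and \<open>c = (m + 1) div 2\<close>. The source component of the digraph is the rotational
  tournament on \<open>n\<close> vertices, in which every vertex beats the next \<open>m\<close> in cyclic order. Each of the
  other \<open>\<Delta>\<close> components is a directed cycle on \<open>n\<close> vertices, and every tournament vertex \<open>p\<close> sends arcs
  to the copies, in all these cycles, of \<open>p\<close> itself and of the vertices that \<open>p\<close> beats. Thus a
  tournament vertex \<open>r\<close> and its copy in a cycle (its twin) are equally far from every tournament vertex
  other than \<open>r\<close>, and both are unreachable from all other cycles.

  The robber can stay in the tournament for ever without being located by fewer than \<open>c + \<Delta>\<close> cops.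
  Standing at \<open>a\<close>, he may go to any of the \<open>m + 1\<close> vertices of the closed out-neighbourhood of \<open>a\<close>, and
  also to their twins. If some cycle contains no probe, then at most \<open>c + \<Delta> - 1 \<le> m\<close> vertices are
  probed, so one of his \<open>m + 1\<close> choices is not, and this choice cannot be told from its twin in that
  cycle; this is where \<open>\<Delta> \<le> c\<close> enters. If every cycle contains a probe, at most \<open>c - 1\<close> probes are left
  for the tournament. The closed out-neighbourhood of \<open>a\<close> is a cyclic interval with \<open>m\<close> gaps between
  consecutive vertices, and one probe separates the two sides of at most two gaps; since
  \<open>2 * (c - 1) < m\<close>, two consecutive vertices remain indistinguishable
  (\<open>card_separated_gaps\<close>, \<open>not_cops_win_G\<close>).

  Conversely \<open>c + \<Delta>\<close> cops need only two probes (\<open>cops_win_G\<close>). In each of them one cop on every cycle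
  identifies a robber who is there, because distances along a directed cycle are distinct. The other
  \<open>c\<close> cops first probe every second vertex of \<open>m + 1, \<dots>, 2 * m\<close>, which leaves at most two consecutive
  candidates \<open>x\<close>, \<open>x + 1\<close> with \<open>x < m\<close>; after his move the robber is among \<open>x, \<dots>, x + m + 1\<close>, and
  probing \<open>x + 1, x + 3, \<dots>, x + m\<close> resolves all of these.

  The tournament by itself is the case of no cycles, so its localization number is \<open>c\<close>, and that of a
  directed cycle is \<open>1 \<le> c\<close>. Hence \<open>c\<close> is the maximum over the components.
\<close>

section \<open>The game\<close>

definition stay_or_move :: "('a, 'b) pre_digraph \<Rightarrow> 'a \<Rightarrow> 'a \<Rightarrow> bool" where
  "stay_or_move G a b \<longleftrightarrow> a = b \<or> a \<rightarrow>\<^bsub>G\<^esub> b"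

definition probe :: "('a, 'b) pre_digraph \<Rightarrow> 'a list \<Rightarrow> 'a \<Rightarrow> ereal list" where
  "probe G P v = map (\<lambda>u. ddist G u v) P"

lemma probe_eq_iff: "probe G P v = probe G P w \<longleftrightarrow> (\<forall>u\<in>set P. ddist G u v = ddist G u w)"
  by (simp add: probe_def)

lemma robber_play_iff:
  "robber_play G x \<longleftrightarrow> x 0 \<in> verts G \<and> (\<forall>t. stay_or_move G (x t) (x (Suc t)))"
  unfolding robber_play_def stay_or_move_def by metis

lemma answers_Suc_probe:
  "answers G \<sigma> x (Suc n) = answers G \<sigma> x n @ [probe G (\<sigma> (answers G \<sigma> x n)) (x n)]"
  by (simp add: probe_def)

lemma answers_cong_prefix:
  assumes "\<And>t. t < n \<Longrightarrow> x t = y t"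
  shows "answers G \<sigma> x n = answers G \<sigma> y n"
  using assms by (induction n) simp_all

text \<open>
  The robber walks inside \<open>R\<close>. As the strategy of the cops is deterministic and the answers so far
  determine the next probe \<open>P\<close>, he can foresee it before he moves, and he moves to a vertex \<open>r\<close> for
  which some other vertex \<open>w\<close>, also within his reach, would give the same answer. The play that agrees
  with his own up to the previous round and then moves to \<open>w\<close> shows that he is not located.
\<close>
lemma not_cops_win_if_always_ambiguous:
  assumes start: "r\<^sub>0 \<in> R" and R: "R \<subseteq> verts G"
    and ambiguous: "\<And>a P. a \<in> R \<Longrightarrow> length P = k \<Longrightarrow> set P \<subseteq> verts G \<Longrightarrow>
      \<exists>r\<in>R. \<exists>w\<in>verts G. r \<noteq> w \<and> stay_or_move G a r \<and> stay_or_move G a w \<and> probe G P r = probe G P w"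
  shows "\<not> cops_win G k"
proof
  assume "cops_win G k"
  then obtain \<sigma> where \<sigma>: "cop_strategy G k \<sigma>"
    and win: "\<And>x. robber_play G x \<Longrightarrow> \<exists>n v. possible_positions G \<sigma> x n = {v}"
    by (auto simp: cops_win_def)
  have "\<forall>a h. \<exists>r. a \<in> R \<longrightarrow> r \<in> R \<and> stay_or_move G a r \<and> (\<exists>w\<in>verts G. r \<noteq> w \<and> stay_or_move G a w \<and>
      probe G (\<sigma> h) r = probe G (\<sigma> h) w)"
    using ambiguous \<sigma> unfolding cop_strategy_def by metis
  then obtain move where move: "\<And>a h. a \<in> R \<Longrightarrow> move a h \<in> R \<and> stay_or_move G a (move a h) \<and>
      (\<exists>w\<in>verts G. move a h \<noteq> w \<and> stay_or_move G a w \<and> probe G (\<sigma> h) (move a h) = probe G (\<sigma> h) w)"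
    by metis
  \<comment> \<open>The state is the robber's position before his move together with the answers given so far;
    the vertex \<open>r\<^sub>0\<close> is only a fictitious position before round \<open>0\<close>.\<close>
  define st where "st = rec_nat (r\<^sub>0, []) (\<lambda>_ (a, h). (move a h, h @ [probe G (\<sigma> h) (move a h)]))"
  have st_0: "st 0 = (r\<^sub>0, [])"
    and st_Suc: "st (Suc n) = (move (fst (st n)) (snd (st n)),
      snd (st n) @ [probe G (\<sigma> (snd (st n))) (move (fst (st n)) (snd (st n)))])" for n
    by (simp_all add: st_def split_beta)
  define x where "x n = fst (st (Suc n))" for n
  have answers_x: "answers G \<sigma> x n = snd (st n)" for n
    by (induction n) (simp_all add: st_0 st_Suc x_def answers_Suc_probe del: answers.simps(2))
  have st_R: "fst (st n) \<in> R" for n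
    using start move by (induction n) (simp_all add: st_0 st_Suc)
  have x_R: "x n \<in> R" for n
    using st_R by (simp add: x_def)
  have step_st: "stay_or_move G (fst (st n)) (x n)" for n
    using move[OF st_R] by (simp add: x_def st_Suc)
  have x_play: "robber_play G x"
    using step_st[of "Suc _"] x_R R by (auto simp: robber_play_iff x_def)
  then obtain n v where singleton: "possible_positions G \<sigma> x n = {v}"
    using win by blast
  obtain w where w: "w \<in> verts G" "x n \<noteq> w" "stay_or_move G (fst (st n)) w"
    "probe G (\<sigma> (snd (st n))) (x n) = probe G (\<sigma> (snd (st n))) w"
    using move[OF st_R[of n], of "snd (st n)"] by (auto simp: x_def st_Suc)
  define y where "y t = (if t < n then x t else w)" for t
  have "stay_or_move G (y t) (y (Suc t))" for t
  proof -
    consider "Suc t < n" | "Suc t = n" | "t \<ge> n" by linarith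
    then show ?thesis
    proof cases
      case 2
      then show ?thesis using w(3) by (auto simp: y_def x_def)
    qed (use x_play in \<open>auto simp: y_def robber_play_iff stay_or_move_def\<close>)
  qed
  moreover have "y 0 \<in> verts G"
    using w(1) x_R R by (auto simp: y_def)
  ultimately have y_play: "robber_play G y"
    by (simp add: robber_play_iff)
  have same: "answers G \<sigma> y n = answers G \<sigma> x n"
    by (rule answers_cong_prefix) (simp add: y_def)
  have "answers G \<sigma> y (Suc n) = answers G \<sigma> x (Suc n)"
    unfolding answers_Suc_probe same using w(4) by (simp add: y_def answers_x)
  then have "y n \<in> possible_positions G \<sigma> x n" "x n \<in> possible_positions G \<sigma> x n"
    using y_play x_play unfolding possible_positions_def by blast+
  then show False
    using singleton w(2) by (auto simp: y_def)
qed

text \<open>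
  The second probe \<open>Q\<close> is chosen from the answer to the first probe \<open>P\<close>, so it has to work for the whole
  class of vertices with that answer: no two vertices reachable in at most one step from the class may
  look alike. A class with a single vertex is already a win.
\<close>
lemma (in wf_digraph) cops_win_in_two_probes:
  assumes P: "length P = k" "set P \<subseteq> verts G"
    and second: "\<And>u. u \<in> verts G \<Longrightarrow>
      (\<forall>v\<in>verts G. probe G P v = probe G P u \<longrightarrow> v = u) \<or>
      (\<exists>Q. length Q = k \<and> set Q \<subseteq> verts G \<and>
        (\<forall>v\<in>verts G. \<forall>w\<in>verts G. probe G P v = probe G P u \<longrightarrow> probe G P w = probe G P u \<longrightarrow>
          (\<forall>v' w'. stay_or_move G v v' \<longrightarrow> stay_or_move G w w' \<longrightarrow> probe G Q v' = probe G Q w' \<longrightarrow> v' = w')))"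
  shows "cops_win G k"
proof -
  define resolves where "resolves Q \<alpha> \<longleftrightarrow> length Q = k \<and> set Q \<subseteq> verts G \<and>
        (\<forall>v\<in>verts G. \<forall>w\<in>verts G. probe G P v = \<alpha> \<longrightarrow> probe G P w = \<alpha> \<longrightarrow>
          (\<forall>v' w'. stay_or_move G v v' \<longrightarrow> stay_or_move G w w' \<longrightarrow> probe G Q v' = probe G Q w' \<longrightarrow> v' = w'))"
    for Q \<alpha>
  define \<sigma> where "\<sigma> h = (if h = [] \<or> (\<nexists>Q. resolves Q (hd h)) then P else SOME Q. resolves Q (hd h))"
    for h
  have \<sigma>_later: "resolves (\<sigma> h) (hd h)" if "h \<noteq> []" "resolves Q (hd h)" for h Q
    using that someI[of "\<lambda>Q. resolves Q (hd h)" Q] by (simp add: \<sigma>_def) blast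
  have strategy: "cop_strategy G k \<sigma>"
    unfolding cop_strategy_def
  proof
    fix h show "length (\<sigma> h) = k \<and> set (\<sigma> h) \<subseteq> verts G"
    proof (cases "h = [] \<or> (\<nexists>Q. resolves Q (hd h))")
      case True
      then show ?thesis using P by (simp only: \<sigma>_def if_True)
    next
      case False
      then have "resolves (\<sigma> h) (hd h)" using \<sigma>_later by blast
      then show ?thesis by (simp only: resolves_def)
    qed
  qed
  have "\<exists>n v. possible_positions G \<sigma> x n = {v}" if x: "robber_play G x" for x
  proof -
    have first_probe: "\<sigma> [] = P"
      by (simp add: \<sigma>_def)
    have first_answer: "answers G \<sigma> y (Suc 0) = [probe G P (y 0)]" for y
      by (simp add: answers_Suc_probe first_probe del: answers.simps(2))
    have x0: "x 0 \<in> verts G"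
      using x by (simp add: robber_play_def)
    show ?thesis
    proof (cases "\<forall>v\<in>verts G. probe G P v = probe G P (x 0) \<longrightarrow> v = x 0")
      case True
      have "possible_positions G \<sigma> x 0 = {x 0}"
        using True x by (auto simp: possible_positions_def first_answer robber_play_def
            simp del: answers.simps(2))
      then show ?thesis by blast
    next
      case False
      then obtain Q where "resolves Q (probe G P (x 0))"
        using second[OF x0] by (auto simp: resolves_def)
      then have res: "resolves (\<sigma> [probe G P (x 0)]) (probe G P (x 0))"
        using \<sigma>_later[of "[probe G P (x 0)]"] by simp
      have "y 1 = x 1" if y: "robber_play G y"
        and same: "answers G \<sigma> y (Suc 1) = answers G \<sigma> x (Suc 1)" for y
      proof -
        have "probe G P (y 0) = probe G P (x 0)"
          and "probe G (\<sigma> [probe G P (x 0)]) (y 1) = probe G (\<sigma> [probe G P (x 0)]) (x 1)"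
          using same by (auto simp: first_probe answers_Suc_probe simp del: answers.simps(2))
        moreover have "stay_or_move G (y 0) (y 1)" "stay_or_move G (x 0) (x 1)" "y 0 \<in> verts G"
          using x y by (simp_all add: robber_play_iff)
        ultimately show ?thesis
          using res x0 unfolding resolves_def by blast
      qed
      then have "possible_positions G \<sigma> x 1 = {x 1}"
        using x unfolding possible_positions_def by blast
      then show ?thesis by blast
    qed
  qed
  then show ?thesis
    using strategy unfolding cops_win_def by blast
qed

lemma localization_number_eqI:
  assumes "0 < k" "cops_win G k" "\<And>j. 0 < j \<Longrightarrow> j < k \<Longrightarrow> \<not> cops_win G j"
  shows "\<zeta> G = k"
  unfolding localization_number_def
  using assms by (intro Least_equality) (auto simp: not_less[symmetric])

section \<open>Distances\<close>

lemma (in wf_digraph) ddist_attained: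
  assumes "u \<rightarrow>\<^sup>* v"
  obtains p where "awalk u p v" "ddist G u v = ereal (real (length p))"
    "\<forall>q. awalk u q v \<longrightarrow> length p \<le> length q"
proof -
  have "\<exists>p. awalk u p v"
    using assms by (simp add: reachable_awalk)
  then obtain p where p: "awalk u p v" and least: "\<forall>q. awalk u q v \<longrightarrow> length p \<le> length q"
    using ex_has_least_nat[of "\<lambda>p. awalk u p v" _ length] by blast
  have "ddist G u v = ereal (real (length p))"
    unfolding ddist_eq_INF_length
    by (rule antisym) (use p least in \<open>auto intro!: INF_lower INF_greatest\<close>)
  then show thesis using p least by (intro that)
qed

lemma (in wf_digraph) ddist_eq_PInf: "\<not> u \<rightarrow>\<^sup>* v \<Longrightarrow> ddist G u v = \<infinity>"
  by (simp add: ddist_def shortest_path_inf)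

lemma (in wf_digraph) ddist_self: "u \<in> verts G \<Longrightarrow> ddist G u u = 0"
proof -
  assume u: "u \<in> verts G"
  then have "u \<rightarrow>\<^sup>* u" by simp
  then obtain p where "awalk u p u" and p: "ddist G u u = ereal (real (length p))"
    and least: "\<forall>q. awalk u q u \<longrightarrow> length p \<le> length q"
    by (rule ddist_attained)
  show ?thesis
    using least[rule_format, of "[]"] p u by (simp add: awalk_Nil_iff)
qed

lemma (in wf_digraph) ddist_arc:
  assumes "u \<rightarrow> v" "u \<noteq> v"
  shows "ddist G u v = 1"
proof -
  obtain e where e: "e \<in> arcs G" "tail G e = u" "head G e = v"
    using assms by auto
  obtain p where p: "awalk u p v" "ddist G u v = ereal (real (length p))"
    and least: "\<forall>q. awalk u q v \<longrightarrow> length p \<le> length q"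
    by (rule ddist_attained[OF reachable_adjI[OF assms(1)]])
  have "length p \<le> 1"
    using least[rule_format, of "[e]"] e by (auto simp: awalk_Cons_iff awalk_Nil_iff)
  moreover have "p \<noteq> []"
    using p(1) assms(2) by (auto simp: awalk_Nil_iff)
  ultimately have "length p = 1"
    by (cases p) auto
  then show ?thesis using p(2) by (simp add: one_ereal_def)
qed

lemma (in wf_digraph) ddist_two_arcs:
  assumes "u \<rightarrow> w" "w \<rightarrow> v" "u \<noteq> v" "\<not> u \<rightarrow> v"
  shows "ddist G u v = 2"
proof -
  obtain e f where e: "e \<in> arcs G" "tail G e = u" "head G e = w"
    and f: "f \<in> arcs G" "tail G f = w" "head G f = v"
    using assms by (auto elim!: reachableE)
  have "u \<rightarrow>\<^sup>* v"
    by (rule reachable_adj_trans[OF reachable_adjI[OF assms(1)] assms(2)])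
  then obtain p where p: "awalk u p v" "ddist G u v = ereal (real (length p))"
    and least: "\<forall>q. awalk u q v \<longrightarrow> length p \<le> length q"
    by (rule ddist_attained)
  have "length p \<le> 2"
    using least[rule_format, of "[e, f]"] e f by (auto simp: awalk_Cons_iff awalk_Nil_iff)
  moreover have "length p \<noteq> 0"
    using p(1) assms(3) by (auto simp: awalk_Nil_iff)
  moreover have "length p \<noteq> 1"
  proof
    assume "length p = 1"
    then obtain g where "p = [g]"
      by (auto simp: length_Suc_conv)
    then show False
      using p(1) assms(4) by (auto simp: awalk_Cons_iff awalk_Nil_iff arcs_ends_conv)
  qed
  ultimately have "length p = 2"
    by linarith
  then show ?thesis using p(2) by simp
qed

section \<open>The digraph\<close>

text \<open>
  Digraphs given by a relation on a vertex set, so that taking an induced subdigraph only shrinks the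
  set and one relation can serve the whole digraph and all its components.
\<close>
definition rel_digraph :: "'a set \<Rightarrow> ('a \<Rightarrow> 'a \<Rightarrow> bool) \<Rightarrow> ('a, 'a \<times> 'a) pre_digraph" where
  "rel_digraph V E = \<lparr>verts = V, arcs = {(u, v). u \<in> V \<and> v \<in> V \<and> E u v}, tail = fst, head = snd\<rparr>"

lemma rel_digraph_simps [simp]:
  "verts (rel_digraph V E) = V"
  "arcs (rel_digraph V E) = {(u, v). u \<in> V \<and> v \<in> V \<and> E u v}"
  "tail (rel_digraph V E) = fst"
  "head (rel_digraph V E) = snd"
  "arcs_ends (rel_digraph V E) = {(u, v). u \<in> V \<and> v \<in> V \<and> E u v}"
  by (auto simp: rel_digraph_def arcs_ends_conv)

lemma wf_rel_digraph: "wf_digraph (rel_digraph V E)"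
  by unfold_locales auto

lemma induce_rel_digraph: "S \<subseteq> V \<Longrightarrow> rel_digraph V E \<restriction> S = rel_digraph S E"
  by (auto simp: induce_subgraph_def rel_digraph_def)

lemma oriented_rel_digraph:
  assumes "finite V" "V \<noteq> {}" and asym: "\<And>u v. E u v \<Longrightarrow> \<not> E v u"
  shows "oriented_digraph (rel_digraph V E)"
proof -
  have "{(u, v). u \<in> V \<and> v \<in> V \<and> E u v} \<subseteq> V \<times> V" by auto
  then have "finite {(u, v). u \<in> V \<and> v \<in> V \<and> E u v}"
    using assms(1) by (meson finite_SigmaI finite_subset)
  then have "fin_digraph (rel_digraph V E)"
    using assms(1) by (intro fin_digraph.intro fin_digraph_axioms.intro wf_rel_digraph) simp_all
  moreover have "fst e \<noteq> snd e" if "e \<in> arcs (rel_digraph V E)" for e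
    using that asym[of "fst e" "snd e"] by fastforce
  then have "loopfree_digraph (rel_digraph V E)"
    by (intro loopfree_digraph.intro loopfree_digraph_axioms.intro wf_rel_digraph) simp
  moreover have "nomulti_digraph (rel_digraph V E)"
    by (intro nomulti_digraph.intro nomulti_digraph_axioms.intro wf_rel_digraph)
      (simp add: arc_to_ends_def prod_eq_iff)
  ultimately have "digraph (rel_digraph V E)"
    by (rule digraph.intro)
  moreover have "\<not> v \<rightarrow>\<^bsub>rel_digraph V E\<^esub> u" if "u \<rightarrow>\<^bsub>rel_digraph V E\<^esub> v" for u v
    using that asym[of u v] by simp
  ultimately show ?thesis
    using assms(2) by (intro oriented_digraph.intro oriented_digraph_axioms.intro) simp_all
qed

text \<open>
  A vertex \<open>v\<close> stands for the pair of the component number \<open>v div n\<close> and the offset \<open>v mod n\<close> within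
  that component. Component \<open>0\<close> is the tournament.
\<close>
locale tournament_over_cycles =
  fixes m n :: nat
  assumes n_def: "n = 2 * m + 1" and m_pos: "0 < m"
begin

text \<open>
  The rotational tournament on \<open>{..<n}\<close>: for \<open>u, v < n\<close> the condition says that \<open>(v - u) mod n\<close> lies
  between \<open>1\<close> and \<open>m\<close>. This form without \<open>mod\<close> keeps the case distinctions linear.
\<close>
definition beats :: "nat \<Rightarrow> nat \<Rightarrow> bool" where
  "beats u v \<longleftrightarrow> u < v \<and> v \<le> u + m \<or> v + m < u"

text \<open>
  A tournament vertex also has arcs to its own copies, not only to those of the vertices it beats. So
  wherever the robber can be in the tournament after his move, he could as well be at the twins, even
  if he stays put.
\<close>
definition joins :: "nat \<Rightarrow> nat \<Rightarrow> bool" where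
  "joins u v \<longleftrightarrow> (if u div n = 0 then beats (u mod n) (v mod n) \<or> v div n \<noteq> 0 \<and> u mod n = v mod n
     else v div n = u div n \<and> v mod n = Suc (u mod n) mod n)"

definition block :: "nat \<Rightarrow> nat set" where
  "block i = {v. v div n = i}"

lemma n_gt_2: "2 < n"
  using n_def m_pos by simp

lemma in_block [simp]: "v \<in> block i \<longleftrightarrow> v div n = i"
  by (simp add: block_def)

lemma offset_less [simp]: "v mod n < n"
  using n_gt_2 by simp

lemma beats_asym: "beats u v \<Longrightarrow> \<not> beats v u"
  by (auto simp: beats_def)

lemma beats_irrefl [simp]: "\<not> beats u u"
  by (simp add: beats_def)

text \<open>
  The intermediate vertex is the farthest one that \<open>u\<close> beats, \<open>u + m\<close> modulo \<open>n\<close>: if \<open>v\<close> beats \<open>u\<close>, then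
  \<open>v\<close> is among the \<open>m\<close> vertices following it.
\<close>
lemma beats_two_steps:
  assumes "u < n" "v < n" "u \<noteq> v" "\<not> beats u v"
  obtains w where "w < n" "beats u w" "beats w v"
proof -
  have "\<exists>w<n. beats u w \<and> beats w v"
  proof (cases "u + m < n")
    case True
    then show ?thesis
      using assms n_def m_pos by (intro exI[of _ "u + m"]) (auto simp: beats_def)
  next
    case False
    then show ?thesis
      using assms n_def m_pos by (intro exI[of _ "u + m - n"]) (auto simp: beats_def)
  qed
  then show thesis using that by blast
qed

lemma joins_top [simp]: "u < n \<Longrightarrow> joins u v \<longleftrightarrow> beats u (v mod n) \<or> v div n \<noteq> 0 \<and> u = v mod n"
  by (simp add: joins_def)

lemma joins_asym: "joins u v \<Longrightarrow> \<not> joins v u"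
proof
  assume uv: "joins u v" "joins v u"
  show False
  proof (cases "u div n = 0")
    case True
    then show ?thesis
      using uv beats_asym by (cases "v div n = 0") (auto simp: joins_def)
  next
    case False
    then have "v mod n = Suc (u mod n) mod n" "u mod n = Suc (v mod n) mod n"
      using uv by (auto simp: joins_def split: if_splits)
    moreover have "Suc x mod n = (if Suc x = n then 0 else Suc x)" if "x < n" for x
      using that by auto
    ultimately show ?thesis
      using n_gt_2 offset_less[of u] offset_less[of v] by (auto split: if_splits)
  qed
qed

lemma joins_cycle:
  "0 < i \<Longrightarrow> x < n \<Longrightarrow> y < n \<Longrightarrow> joins (i * n + x) (i * n + y) \<longleftrightarrow> y = Suc x mod n"
  using n_gt_2 by (simp add: joins_def)

lemma joins_block: "joins u v \<Longrightarrow> u div n = 0 \<or> u div n = v div n"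
  by (auto simp: joins_def split: if_splits)

lemma reachable_block:
  assumes "u \<rightarrow>\<^sup>*\<^bsub>rel_digraph V joins\<^esub> v"
  shows "u div n = 0 \<or> u div n = v div n"
  using assms unfolding reachable_def
  by (induction rule: rtrancl_on_induct) (use joins_block in force)+

text \<open>
  Along a directed cycle the end of a walk is determined by its start and its length, so a single probe
  tells all vertices of the cycle apart. This argument avoids computing the distances.
\<close>
lemma cycle_walk_offset:
  assumes "pre_digraph.awalk (rel_digraph V joins) u p v" "u div n \<noteq> 0"
  shows "v mod n = (u mod n + length p) mod n"
  using assms
proof (induction p arbitrary: u)
  case Nil
  then show ?case
    by (simp add: wf_digraph.awalk_Nil_iff[OF wf_rel_digraph])
next
  case (Cons e p)
  define w where "w = snd e"
  have w: "joins u w" "pre_digraph.awalk (rel_digraph V joins) w p v"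
    using Cons.prems(1) by (cases e; simp add: w_def wf_digraph.awalk_Cons_iff[OF wf_rel_digraph])+
  have "w div n = u div n" "w mod n = Suc (u mod n) mod n"
    using w(1) Cons.prems(2) by (auto simp: joins_def)
  then have "v mod n = (Suc (u mod n) mod n + length p) mod n"
    using Cons.IH[OF w(2)] Cons.prems(2) by simp
  also have "\<dots> = (u mod n + length (e # p)) mod n"
    by (simp add: mod_add_left_eq)
  finally show ?case .
qed

lemma cycle_reachable:
  assumes i: "0 < i" and V: "block i \<subseteq> V" and u: "u \<in> block i" and v: "v \<in> block i"
  shows "u \<rightarrow>\<^sup>*\<^bsub>rel_digraph V joins\<^esub> v"
proof -
  interpret wf_digraph "rel_digraph V joins" by (rule wf_rel_digraph)
  have in_V: "i * n + x \<in> V" if "x < n" for x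
    using V that by (auto simp: subset_iff)
  have forward: "(i * n + x) \<rightarrow>\<^sup>*\<^bsub>rel_digraph V joins\<^esub> (i * n + y)" if "x \<le> y" "y < n" for x y
    using that
  proof (induction y rule: dec_induct)
    case base
    then show ?case using in_V by simp
  next
    case (step y)
    then have "(i * n + y) \<rightarrow>\<^bsub>rel_digraph V joins\<^esub> (i * n + Suc y)"
      using in_V[of y] in_V[of "Suc y"] i by (simp add: joins_cycle del: add_Suc_right)
    with step show ?case by (meson Suc_lessD reachable_adj_trans)
  qed
  have wrap: "(i * n + (n - 1)) \<rightarrow>\<^bsub>rel_digraph V joins\<^esub> (i * n + 0)"
    using in_V[of "n - 1"] in_V[of 0] i n_gt_2 joins_cycle[of i "n - 1" 0] by simp
  obtain x y where "u = i * n + x" "v = i * n + y" "x < n" "y < n"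
    using u v n_gt_2 by (metis div_mult_mod_eq in_block offset_less)
  moreover have "(i * n + x) \<rightarrow>\<^sup>*\<^bsub>rel_digraph V joins\<^esub> (i * n + (n - 1))"
    "(i * n + 0) \<rightarrow>\<^sup>*\<^bsub>rel_digraph V joins\<^esub> (i * n + y)"
    using \<open>x < n\<close> \<open>y < n\<close> n_gt_2 by (intro forward; simp)+
  ultimately show ?thesis
    using wrap by (meson reachable_adj_trans reachable_trans)
qed

text \<open>
  Vertices outside the cycle are at infinite distance from \<open>i * n\<close>, hence \<open>w\<close> may be arbitrary.
\<close>
lemma cycle_probe_identifies:
  assumes i: "0 < i" and V: "block i \<subseteq> V" and v: "v \<in> block i"
    and same: "ddist (rel_digraph V joins) (i * n) v = ddist (rel_digraph V joins) (i * n) w"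
  shows "v = w"
proof -
  interpret wf_digraph "rel_digraph V joins" by (rule wf_rel_digraph)
  have src: "i * n div n = i" "i * n mod n = 0"
    using n_gt_2 by auto
  have "(i * n) \<rightarrow>\<^sup>*\<^bsub>rel_digraph V joins\<^esub> v"
    using cycle_reachable[OF i V _ v] src by simp
  then obtain p where p: "awalk (i * n) p v" "ddist (rel_digraph V joins) (i * n) v = ereal (real (length p))"
    by (rule ddist_attained)
  have w_reachable: "(i * n) \<rightarrow>\<^sup>*\<^bsub>rel_digraph V joins\<^esub> w"
  proof (rule ccontr)
    assume "\<not> (i * n) \<rightarrow>\<^sup>*\<^bsub>rel_digraph V joins\<^esub> w"
    then have "ddist (rel_digraph V joins) (i * n) w = \<infinity>" by (rule ddist_eq_PInf)
    then show False using same p(2) by simp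
  qed
  then obtain q where q: "awalk (i * n) q w" "ddist (rel_digraph V joins) (i * n) w = ereal (real (length q))"
    by (rule ddist_attained)
  have "length p = length q"
    using same p(2) q(2) by simp
  then have "v mod n = w mod n"
    using cycle_walk_offset[OF p(1)] cycle_walk_offset[OF q(1)] src i by simp
  moreover have "w div n = v div n"
    using reachable_block[OF w_reachable] src v i by simp
  ultimately show ?thesis by (metis div_mult_mod_eq)
qed

lemma ddist_cycle_outside:
  assumes "p div n \<noteq> 0" "v div n \<noteq> p div n"
  shows "ddist (rel_digraph V joins) p v = \<infinity>"
  using assms reachable_block wf_digraph.ddist_eq_PInf[OF wf_rel_digraph] by metis

text \<open>
  The tournament has diameter two, and the second arc of a path of length two may just as well end in
  the copy of its end vertex in a cycle.
\<close>
lemma ddist_top: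
  assumes V: "block 0 \<subseteq> V" and p: "p < n" and v: "v \<in> V"
  shows "ddist (rel_digraph V joins) p v =
    (if p = v then 0 else if joins p v then 1 else 2)"
proof -
  interpret wf_digraph "rel_digraph V joins" by (rule wf_rel_digraph)
  have pV: "p \<in> V" using V p by auto
  show ?thesis
  proof (cases "p = v \<or> joins p v")
    case True
    then show ?thesis using ddist_self[of p] ddist_arc[of p v] pV v by auto
  next
    case False
    have "p \<noteq> v mod n"
    proof
      assume "p = v mod n"
      then have "v div n = 0" using False p by auto
      then have "v < n" using n_gt_2 by (simp add: div_eq_0_iff)
      then show False using False \<open>p = v mod n\<close> by simp
    qed
    moreover have "\<not> beats p (v mod n)" using False p by simp
    ultimately obtain w where w: "w < n" "beats p w" "beats w (v mod n)"
      using beats_two_steps[OF p offset_less] by blast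
    have "p \<rightarrow>\<^bsub>rel_digraph V joins\<^esub> w" "w \<rightarrow>\<^bsub>rel_digraph V joins\<^esub> v"
      using w pV v p V by auto
    then show ?thesis using False ddist_two_arcs[of p w v] by auto
  qed
qed

text \<open>
  The number \<open>D\<close> of cycles is a parameter, so that the tournament component is itself the digraph \<open>G 0\<close>.
\<close>
definition V :: "nat \<Rightarrow> nat set" where
  "V D = {v. v div n \<le> D}"

abbreviation G :: "nat \<Rightarrow> (nat, nat \<times> nat) pre_digraph" where
  "G D \<equiv> rel_digraph (V D) joins"

lemma V_eq: "V D = {..<n * (D + 1)}"
  using n_gt_2 div_less_iff_less_mult[of n _ "D + 1"] by (auto simp: V_def mult.commute less_Suc_eq_le)

lemma block_subset_V: "i \<le> D \<Longrightarrow> block i \<subseteq> V D"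
  by (auto simp: V_def)

lemma top_in_V: "v < n \<Longrightarrow> v \<in> V D"
  by (simp add: V_def)

lemma top_iff: "v div n = 0 \<longleftrightarrow> v < n"
  using n_gt_2 by (simp add: div_eq_0_iff)

section \<open>A winning strategy for the cops\<close>

text \<open>
  Tournament distances are \<open>0\<close>, \<open>1\<close> and \<open>2\<close>, so these two conditions say exactly that probing \<open>p\<close> tells
  \<open>u\<close> from \<open>v\<close>.
\<close>
definition separates :: "nat \<Rightarrow> nat \<Rightarrow> nat \<Rightarrow> bool" where
  "separates p u v \<longleftrightarrow> (p = u) \<noteq> (p = v) \<or> beats p u \<noteq> beats p v"

lemma ddist_top_eq_iff:
  assumes "p < n" "u < n" "v < n"
  shows "ddist (G D) p u = ddist (G D) p v \<longleftrightarrow> \<not> separates p u v"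
proof -
  have "ddist (G D) p w = (if p = w then 0 else if beats p w then 1 else 2)" if "w < n" for w
    using ddist_top[OF block_subset_V[of 0 D] assms(1) top_in_V[OF that]] that assms(1) by simp
  then show ?thesis
    using assms by (auto simp: separates_def)
qed

text \<open>
  Both rounds use a probe of this shape: the first one with \<open>x = m\<close>, the second one with \<open>x\<close> the smaller
  of the two remaining candidates.
\<close>
definition probes :: "nat \<Rightarrow> nat \<Rightarrow> nat list" where
  "probes D x = map (\<lambda>j. x + 1 + 2 * j) [0..<(m + 1) div 2] @ map (\<lambda>i. i * n) [1..<D + 1]"

lemma length_probes: "length (probes D x) = (m + 1) div 2 + D"
  by (simp add: probes_def)

lemma probes_subset: "odd m \<Longrightarrow> x \<le> m \<Longrightarrow> set (probes D x) \<subseteq> V D"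
proof -
  assume "odd m" "x \<le> m"
  then have "x + 1 + 2 * j < n" if "j < (m + 1) div 2" for j
    using that n_def by presburger
  moreover have "i * n div n = i" for i
    using n_gt_2 by simp
  ultimately show ?thesis
    unfolding probes_def V_def by (auto simp flip: top_iff)
qed

lemma unresolved_in_top:
  assumes "v \<in> V D" "w \<in> V D" "probe (G D) (probes D x) v = probe (G D) (probes D x) w" "v \<noteq> w"
  shows "v < n"
proof (rule ccontr)
  assume "\<not> v < n"
  then have i: "0 < v div n" "v div n \<le> D"
    using assms(1) n_gt_2 by (auto simp: V_def div_greater_zero_iff)
  then have "v div n * n \<in> set (probes D x)"
    by (auto simp: probes_def)
  then have "ddist (G D) (v div n * n) v = ddist (G D) (v div n * n) w"
    using assms(3) unfolding probe_eq_iff by blast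
  then have "v = w"
    by (rule cycle_probe_identifies[OF i(1) block_subset_V[OF i(2)], rotated]) simp
  then show False using assms(4) by blast
qed

lemma unresolved_not_separated:
  assumes "odd m" "x \<le> m" "v < n" "w < n" "j < (m + 1) div 2"
    and "probe (G D) (probes D x) v = probe (G D) (probes D x) w"
  shows "\<not> separates (x + 1 + 2 * j) v w"
proof -
  have "x + 1 + 2 * j < n"
    using assms(1,2,5) n_def by presburger
  moreover have "x + 1 + 2 * j \<in> set (probes D x)"
    using assms(5) by (auto simp: probes_def)
  ultimately show ?thesis
    using assms(3,4,6) ddist_top_eq_iff unfolding probe_eq_iff by blast
qed

text \<open>
  The probed vertices are the even \<open>p\<close> with \<open>m < p < n\<close>. Probing \<open>p\<close> cuts the cyclic order on both sides
  of \<open>p\<close> and between \<open>p - m - 1\<close> and \<open>p - m\<close>. The cuts of the first kind isolate every vertex above \<open>m\<close>,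
  and those of the second kind cut \<open>{..m}\<close> into pieces of at most two vertices.
\<close>
lemma first_probe_leaves_consecutive:
  assumes m: "odd m" and uv: "u < v" "v < n"
    and unsep: "\<And>j. j < (m + 1) div 2 \<Longrightarrow> \<not> separates (m + 1 + 2 * j) u v"
  shows "v = u + 1 \<and> v \<le> m"
proof -
  have unsep': "(p = u \<longleftrightarrow> p = v) \<and> (beats p u \<longleftrightarrow> beats p v)" if "even p" "m < p" "p < n" for p
  proof -
    have "p = m + 1 + 2 * ((p - m) div 2)" "(p - m) div 2 < (m + 1) div 2"
      using that m n_def by presburger+
    then show ?thesis
      using unsep[of "(p - m) div 2"] by (simp add: separates_def)
  qed
  have "v \<le> m"
  proof (rule ccontr)
    assume large: "\<not> v \<le> m"
    show False
    proof (cases "even v")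
      case True
      then show ?thesis
        using unsep'[of v] large uv by simp
    next
      case False
      then have "m + 2 \<le> v" "v + 1 < n" "even (v - 1)" "even (v + 1)"
        using large uv m n_def by presburger+
      then have "beats (v - 1) u" "\<not> (beats (v + 1) u)"
      proof -
        show "\<not> (beats (v + 1) u)"
          using unsep'[of "v + 1"] \<open>m + 2 \<le> v\<close> \<open>v + 1 < n\<close> \<open>even (v + 1)\<close> m_pos
          by (simp add: beats_def)
        \<comment> \<open>The neighbour \<open>v - 1\<close> beats \<open>v\<close>; as it is not \<open>v\<close>, it must beat \<open>u\<close> as well, which places \<open>u\<close>
          more than \<open>m\<close> below it. Then \<open>v + 1\<close> would beat \<open>u\<close> too, but it does not beat \<open>v\<close>.\<close>
        have "m < v - 1" "v - 1 < n"
          using \<open>m + 2 \<le> v\<close> \<open>v + 1 < n\<close> by linarith+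
        moreover have "beats (v - 1) v"
          using \<open>m + 2 \<le> v\<close> m_pos unfolding beats_def by linarith
        ultimately show "beats (v - 1) u"
          using unsep'[of "v - 1"] \<open>even (v - 1)\<close> by blast
      qed
      then show ?thesis
        using \<open>m + 2 \<le> v\<close> uv unfolding beats_def by linarith
    qed
  qed
  moreover have "v = u + 1"
  proof (rule ccontr)
    assume far: "v \<noteq> u + 1"
    \<comment> \<open>The probe \<open>p\<close> that beats exactly the vertices of \<open>{..m}\<close> up to \<open>u\<close>, or up to \<open>u + 1\<close>.\<close>
    define p where "p = (if even u then u + m + 1 else u + m + 2)"
    have "even p" "m < p" "p < n" "p = u + m + 1 \<or> p = u + m + 2"
      using m far uv \<open>v \<le> m\<close> n_def unfolding p_def by presburger+
    then have "beats p u" "\<not> beats p v"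
      using far uv \<open>v \<le> m\<close> unfolding beats_def by linarith+
    then show False
      using unsep'[OF \<open>even p\<close> \<open>m < p\<close> \<open>p < n\<close>] by blast
  qed
  ultimately show ?thesis by simp
qed

text \<open>
  The probed vertices \<open>x + 1, x + 3, \<dots>, x + m\<close> contain \<open>u\<close> or \<open>u + 1\<close>. The vertex \<open>u\<close> is recognised by
  being probed itself, and \<open>u + 1\<close> does not beat \<open>u\<close> but equals or beats \<open>v\<close>. The condition \<open>x + 1 \<le> m\<close>
  makes \<open>{x..x + m + 1}\<close> an interval of \<open>{..<n}\<close> that does not wrap around.
\<close>
lemma second_probe_resolves:
  assumes m: "odd m" and x: "x + 1 \<le> m" and uv: "x \<le> u" "u < v" "v \<le> x + m + 1"
    and unsep: "\<And>j. j < (m + 1) div 2 \<Longrightarrow> \<not> separates (x + 1 + 2 * j) u v"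
  shows False
proof -
  obtain d where d: "u = x + d"
    using uv(1) le_Suc_ex by blast
  obtain k where k: "m = 2 * k + 1"
    using m by (elim oddE)
  have "\<exists>j. 2 * j + 1 = d \<or> 2 * j = d" by presburger
  then obtain j where j_d: "2 * j + 1 = d \<or> 2 * j = d" by blast
  then have p: "x + 1 + 2 * j = u \<or> x + 1 + 2 * j = u + 1"
    using d by linarith
  have "j \<le> k"
    using j_d uv d k by linarith
  then have j: "j < (m + 1) div 2"
    using k by simp
  have "separates u u v"
    using uv by (simp add: separates_def)
  moreover have "separates (u + 1) u v"
  proof -
    have "\<not> beats (u + 1) u" "u + 1 = v \<or> beats (u + 1) v"
      using x uv m_pos unfolding beats_def by linarith+
    then show ?thesis by (auto simp: separates_def)
  qed
  ultimately show False
    using unsep[OF j] p by metis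
qed

text \<open>
  Two vertices with the same answer always lie in the tournament, because the probed vertex of a cycle
  identifies everything in that cycle. It remains to combine the two preceding lemmas.
\<close>
lemma cops_win_G:
  assumes m: "odd m"
  shows "cops_win (G D) ((m + 1) div 2 + D)"
proof -
  interpret wf_digraph "G D" by (rule wf_rel_digraph)
  define same where "same x v w \<longleftrightarrow> v \<in> V D \<and> w \<in> V D \<and> v \<noteq> w \<and>
    probe (G D) (probes D x) v = probe (G D) (probes D x) w" for x v w
  have same_sym: "same x v w \<Longrightarrow> same x w v" for x v w
    by (auto simp: same_def)
  have same_top: "v < n" "w < n" if "same x v w" for x v w
    using that unresolved_in_top same_sym unfolding same_def by metis+
  have same_unsep: "\<not> separates (x + 1 + 2 * j) v w"
    if "same x v w" "x \<le> m" "j < (m + 1) div 2" for x v w j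
    using unresolved_not_separated[OF m that(2) same_top[OF that(1)] that(3)] that(1)
    unfolding same_def by blast
  have first_less: "w = v + 1 \<and> w \<le> m" if "same m v w" "v < w" for v w
    using first_probe_leaves_consecutive[OF m that(2)] same_top[OF that(1)]
      same_unsep[OF that(1)] by blast
  have first: "(w = v + 1 \<and> w \<le> m) \<or> (v = w + 1 \<and> v \<le> m)" if "same m v w" for v w
    using that first_less same_sym unfolding same_def by (metis linorder_neqE_nat)
  show ?thesis
  proof (rule cops_win_in_two_probes)
    show "length (probes D m) = (m + 1) div 2 + D" by (rule length_probes)
    show "set (probes D m) \<subseteq> verts (G D)" using probes_subset[OF m] by simp
  next
    fix u assume "u \<in> verts (G D)"
    then have uV: "u \<in> V D" by simp
    let ?P = "probes D m"
    have "\<exists>Q. length Q = (m + 1) div 2 + D \<and> set Q \<subseteq> verts (G D) \<and>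
        (\<forall>v\<in>verts (G D). \<forall>w\<in>verts (G D). probe (G D) ?P v = probe (G D) ?P u \<longrightarrow>
          probe (G D) ?P w = probe (G D) ?P u \<longrightarrow>
          (\<forall>v' w'. stay_or_move (G D) v v' \<longrightarrow> stay_or_move (G D) w w' \<longrightarrow>
            probe (G D) Q v' = probe (G D) Q w' \<longrightarrow> v' = w'))"
      if v\<^sub>0: "same m u v\<^sub>0" for v\<^sub>0
    proof -
      define x where "x = min u v\<^sub>0"
      have x: "x + 1 \<le> m" "(u = x \<and> v\<^sub>0 = x + 1) \<or> (u = x + 1 \<and> v\<^sub>0 = x)"
        using first[OF v\<^sub>0] by (auto simp: x_def)
      have candidates: "v = x \<or> v = x + 1"
        if "v \<in> V D" "probe (G D) ?P v = probe (G D) ?P u" for v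
      proof (rule ccontr)
        assume v: "\<not> (v = x \<or> v = x + 1)"
        then have "same m v u" "same m v v\<^sub>0"
          using that v\<^sub>0 x uV unfolding same_def by auto
        from first[OF this(1)] first[OF this(2)] v x show False by auto
      qed
      have next_pos: "v' \<in> V D \<and> (v' < n \<longrightarrow> x \<le> v' \<and> v' \<le> x + m + 1)"
        if "v = x \<or> v = x + 1" "stay_or_move (G D) v v'" for v v'
      proof -
        have "v < n" using that(1) x(1) n_def by auto
        then show ?thesis
          using that x(1) top_in_V[of v] by (auto simp: stay_or_move_def beats_def)
      qed
      have resolved: "v' = w'" if "v = x \<or> v = x + 1" "stay_or_move (G D) v v'"
        "w = x \<or> w = x + 1" "stay_or_move (G D) w w'"
        "probe (G D) (probes D x) v' = probe (G D) (probes D x) w'" for v w v' w'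
      proof (rule ccontr)
        assume neq: "v' \<noteq> w'"
        then have s: "same x v' w'"
          using that next_pos unfolding same_def by blast
        have range: "x \<le> v'" "v' \<le> x + m + 1" "x \<le> w'" "w' \<le> x + m + 1"
          using next_pos[OF that(1,2)] next_pos[OF that(3,4)] same_top[OF s] by simp_all
        have xm: "x \<le> m" using x(1) by simp
        show False
        proof (cases "v' < w'")
          case True
          then show False
            using second_probe_resolves[OF m x(1) range(1) True range(4)] same_unsep[OF s xm] by blast
        next
          case False
          then have less: "w' < v'" using neq by simp
          show False
            using second_probe_resolves[OF m x(1) range(3) less range(2)] same_unsep[OF same_sym[OF s] xm]
            by blast
        qed
      qed
      show ?thesis
      proof (intro exI[of _ "probes D x"] conjI ballI allI impI)
        show "set (probes D x) \<subseteq> verts (G D)"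
          using probes_subset[OF m, of x D] x(1) by simp
      next
        fix v w v' w'
        assume v: "v \<in> verts (G D)" "probe (G D) ?P v = probe (G D) ?P u"
          and w: "w \<in> verts (G D)" "probe (G D) ?P w = probe (G D) ?P u"
          and moves: "stay_or_move (G D) v v'" "stay_or_move (G D) w w'"
          and answer: "probe (G D) (probes D x) v' = probe (G D) (probes D x) w'"
        show "v' = w'"
          using resolved[OF candidates[OF v[simplified]] moves(1) candidates[OF w[simplified]] moves(2) answer] .
      qed (rule length_probes)
    qed
    moreover have "\<forall>v\<in>verts (G D). probe (G D) ?P v = probe (G D) ?P u \<longrightarrow> v = u"
      if "\<nexists>v. same m u v"
      using that uV unfolding same_def rel_digraph_simps(1) by metis
    ultimately show "(\<forall>v\<in>verts (G D). probe (G D) ?P v = probe (G D) ?P u \<longrightarrow> v = u) \<or>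
      (\<exists>Q. length Q = (m + 1) div 2 + D \<and> set Q \<subseteq> verts (G D) \<and>
        (\<forall>v\<in>verts (G D). \<forall>w\<in>verts (G D). probe (G D) ?P v = probe (G D) ?P u \<longrightarrow>
          probe (G D) ?P w = probe (G D) ?P u \<longrightarrow>
          (\<forall>v' w'. stay_or_move (G D) v v' \<longrightarrow> stay_or_move (G D) w w' \<longrightarrow>
            probe (G D) Q v' = probe (G D) Q w' \<longrightarrow> v' = w')))"
      by blast
  qed
qed

section \<open>An evasion strategy for the robber\<close>

text \<open>
  For \<open>a < n\<close>, the values at \<open>0, \<dots>, m\<close> are the vertex \<open>a\<close> and the vertices it beats, in cyclic order.
\<close>
definition rot :: "nat \<Rightarrow> nat \<Rightarrow> nat" where
  "rot a t = (if a + t < n then a + t else a + t - n)"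

lemma rot_cases: "a + t < n \<and> rot a t = a + t \<or> n \<le> a + t \<and> rot a t + n = a + t"
  by (simp add: rot_def)

lemma rot_less: "a < n \<Longrightarrow> t \<le> m \<Longrightarrow> rot a t < n"
  using rot_cases[of a t] n_def by linarith

lemma inj_on_rot:
  assumes "a < n"
  shows "inj_on (rot a) {..m}"
proof (rule inj_onI)
  fix s t assume "s \<in> {..m}" "t \<in> {..m}" "rot a s = rot a t"
  then show "s = t"
    using rot_cases[of a s] rot_cases[of a t] n_def unfolding atMost_iff by linarith
qed

lemma rot_closed_out_neighbour: "a < n \<Longrightarrow> t \<le> m \<Longrightarrow> a = rot a t \<or> beats a (rot a t)"
  using rot_cases[of a t] n_def unfolding beats_def by linarith

lemma beats_rot_iff:
  assumes a: "a < n" and p: "p < n" and s: "s \<le> m"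
    and q: "a \<le> p \<and> q + a = p \<or> p < a \<and> q + a = p + n"
  shows "p = rot a s \<longleftrightarrow> q = s" "beats p (rot a s) \<longleftrightarrow> beats q s"
proof -
  define r where "r = rot a s"
  have r: "a + s < n \<and> r = a + s \<or> n \<le> a + s \<and> r + n = a + s"
    unfolding r_def by (rule rot_cases)
  have "p = r \<longleftrightarrow> q = s"
    using r q a p s n_def by (elim disjE conjE; intro iffI; linarith)
  moreover have "beats p r \<longleftrightarrow> beats q s"
    using r q a p s n_def unfolding beats_def by (elim disjE conjE; intro iffI; linarith)
  ultimately show "p = rot a s \<longleftrightarrow> q = s" "beats p (rot a s) \<longleftrightarrow> beats q s"
    by (simp_all add: r_def)
qed

text \<open>
  In coordinates relative to \<open>a\<close> the probed vertex has offset \<open>q\<close>, and the vertices in question have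
  offsets \<open>0, \<dots>, m\<close>. A probe inside this interval separates only the two gaps next to it, since it does
  not beat anything before it and beats everything after it. A probe outside separates at most the
  gap just before offset \<open>q - m\<close>, where the vertices that it beats end.
\<close>
lemma card_separated_gaps:
  assumes a: "a < n" and p: "p < n"
  shows "card {t. t < m \<and> separates p (rot a t) (rot a (Suc t))} \<le> 2"
proof -
  define q where "q = (if a \<le> p then p - a else p + n - a)"
  have gap: "Suc t = q \<or> t = q \<or> t + m + 1 = q"
    if t: "t < m" and sep: "separates p (rot a t) (rot a (Suc t))" for t
  proof (rule ccontr)
    assume far: "\<not> (Suc t = q \<or> t = q \<or> t + m + 1 = q)"
    have q: "a \<le> p \<and> q + a = p \<or> p < a \<and> q + a = p + n"
      using a by (simp add: q_def)
    have offset: "(p = rot a s \<longleftrightarrow> q = s) \<and> (beats p (rot a s) \<longleftrightarrow> beats q s)" if "s \<le> m" for s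
      using beats_rot_iff[OF a p that q] by blast
    have "\<not> separates q t (Suc t)"
      using far t unfolding separates_def beats_def by linarith
    then show False
      using sep offset[of t] offset[of "Suc t"] t by (simp add: separates_def)
  qed
  have sub: "{t. t < m \<and> separates p (rot a t) (rot a (Suc t))} \<subseteq> (if q \<le> m then {q - 1, q} else {q - m - 1})"
  proof
    fix t assume "t \<in> {t. t < m \<and> separates p (rot a t) (rot a (Suc t))}"
    then have "t < m" "Suc t = q \<or> t = q \<or> t + m + 1 = q"
      using gap by blast+
    then show "t \<in> (if q \<le> m then {q - 1, q} else {q - m - 1})"
      by auto
  qed
  have "card {t. t < m \<and> separates p (rot a t) (rot a (Suc t))}
      \<le> card (if q \<le> m then {q - 1, q} else {q - m - 1})"
    by (rule card_mono[OF _ sub]) simp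
  also have "\<dots> \<le> 2"
    by (simp add: card_insert_if)
  finally show ?thesis .
qed

lemma unseparated_gap_exists:
  assumes a: "a < n" and Q: "finite Q" "Q \<subseteq> {..<n}" and card: "2 * card Q < m"
  obtains t where "t < m" "\<And>p. p \<in> Q \<Longrightarrow> \<not> separates p (rot a t) (rot a (Suc t))"
proof -
  define gaps where "gaps p = {t. t < m \<and> separates p (rot a t) (rot a (Suc t))}" for p
  have "card (\<Union>p\<in>Q. gaps p) \<le> (\<Sum>p\<in>Q. card (gaps p))"
    using Q(1) by (rule card_UN_le)
  also have "\<dots> \<le> (\<Sum>p\<in>Q. 2)"
    using card_separated_gaps[OF a] Q(2) unfolding gaps_def by (intro sum_mono) auto
  also have "\<dots> < card {..<m}"
    using card by simp
  finally have "\<not> {..<m} \<subseteq> (\<Union>p\<in>Q. gaps p)"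
    using card_mono[of "\<Union>p\<in>Q. gaps p" "{..<m}"] Q(1) by (auto simp: gaps_def not_less[symmetric])
  then obtain t where "t < m" "t \<notin> (\<Union>p\<in>Q. gaps p)"
    by blast
  then show thesis
    by (intro that[of t]) (auto simp: gaps_def)
qed

text \<open>
  A tournament vertex \<open>r\<close> and its copy in cycle \<open>i\<close> can only be told apart by probing \<open>r\<close> or a vertex
  of cycle \<open>i\<close>.
\<close>
lemma ddist_twin_eq:
  assumes p: "p \<in> V D" "p \<noteq> r" "p div n \<noteq> i" and r: "r < n" and i: "0 < i" "i \<le> D"
  shows "ddist (G D) p r = ddist (G D) p (i * n + r)"
proof -
  have twin: "(i * n + r) div n = i" "(i * n + r) mod n = r"
    using r by simp_all
  show ?thesis
  proof (cases "p div n = 0")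
    case True
    then have pn: "p < n" by (simp add: top_iff)
    have "i * n + r \<in> V D"
      using twin i by (simp add: V_def)
    moreover have "p \<noteq> i * n + r"
      using True twin i by auto
    moreover have "joins p (i * n + r) \<longleftrightarrow> beats p r" "joins p r \<longleftrightarrow> beats p r"
      using pn twin r p(2) by simp_all
    ultimately show ?thesis
      using ddist_top[OF block_subset_V[of 0 D] pn] top_in_V[OF r, of D] p(2) by simp
  next
    case False
    have "ddist (G D) p r = \<infinity>" "ddist (G D) p (i * n + r) = \<infinity>"
      using False p(3) r twin by (intro ddist_cycle_outside; simp)+
    then show ?thesis by simp
  qed
qed

lemma card_top_probes:
  assumes "\<And>i. 0 < i \<Longrightarrow> i \<le> D \<Longrightarrow> \<exists>p\<in>set P. p div n = i"
  shows "card (set P \<inter> {..<n}) + D \<le> length P"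
proof -
  obtain f where f: "\<And>i. i \<in> {1..D} \<Longrightarrow> f i \<in> set P \<and> f i div n = i"
    using assms by (metis atLeastAtMost_iff less_eq_Suc_le One_nat_def)
  have "inj_on f {1..D}"
    using f by (metis inj_onI)
  then have "card (f ` {1..D}) = D"
    by (simp add: card_image)
  moreover have "(set P \<inter> {..<n}) \<inter> f ` {1..D} = {}"
    using f n_gt_2 top_iff by fastforce
  ultimately have "card (set P \<inter> {..<n}) + D = card ((set P \<inter> {..<n}) \<union> f ` {1..D})"
    by (subst card_Un_disjoint) simp_all
  also have "\<dots> \<le> card (set P)"
    using f by (intro card_mono) auto
  also have "\<dots> \<le> length P"
    by (rule card_length)
  finally show ?thesis .
qed

text \<open>
  The robber stays in the tournament and always has two indistinguishable moves: twins if some cycle is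
  not probed, and consecutive tournament vertices otherwise.
\<close>
lemma not_cops_win_G:
  assumes D: "D \<le> (m + 1) div 2" and k: "k < (m + 1) div 2 + D"
  shows "\<not> cops_win (G D) k"
proof (rule not_cops_win_if_always_ambiguous[where R = "{..<n}" and r\<^sub>0 = 0])
  show "0 \<in> {..<n}" using n_gt_2 by simp
  show "{..<n} \<subseteq> verts (G D)" by (auto simp: V_def)
next
  fix a P
  assume "a \<in> {..<n}" and P: "length P = k" "set P \<subseteq> verts (G D)"
  then have a: "a < n" by simp
  have PV: "p \<in> V D" if "p \<in> set P" for p
    using P(2) that by auto
  have move_top: "stay_or_move (G D) a (rot a t)" if "t \<le> m" for t
    using rot_closed_out_neighbour[OF a that] rot_less[OF a that] a
    by (auto simp: stay_or_move_def top_in_V)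
  show "\<exists>r\<in>{..<n}. \<exists>w\<in>verts (G D). r \<noteq> w \<and> stay_or_move (G D) a r \<and> stay_or_move (G D) a w \<and>
    probe (G D) P r = probe (G D) P w"
  proof (cases "\<exists>i. 0 < i \<and> i \<le> D \<and> (\<forall>p\<in>set P. p div n \<noteq> i)")
    case True
    then obtain i where i: "0 < i" "i \<le> D" and unprobed: "\<And>p. p \<in> set P \<Longrightarrow> p div n \<noteq> i"
      by blast
    have "card (set P) \<le> length P" by (rule card_length)
    also have "\<dots> < card (rot a ` {..m})"
      using P(1) D k by (simp add: card_image[OF inj_on_rot[OF a]])
    finally have "\<not> rot a ` {..m} \<subseteq> set P"
      using card_mono[of "set P" "rot a ` {..m}"] by auto
    then obtain t where t: "t \<le> m" "rot a t \<notin> set P" by auto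
    define r where "r = rot a t"
    define w where "w = i * n + r"
    have r: "r < n" using rot_less[OF a t(1)] by (simp add: r_def)
    have w: "w div n = i" "w mod n = r" using r by (simp_all add: w_def)
    have "w \<in> verts (G D)" using w i by (simp add: V_def)
    moreover have "r \<noteq> w" using w i r by auto
    moreover have "stay_or_move (G D) a w"
      using rot_closed_out_neighbour[OF a t(1)] w i a top_in_V[OF a]
      by (auto simp: stay_or_move_def r_def V_def)
    moreover have "probe (G D) P r = probe (G D) P w"
      unfolding probe_eq_iff w_def
      using ddist_twin_eq[OF PV _ unprobed r i] t(2) r_def by metis
    ultimately show ?thesis
      using move_top[OF t(1)] r unfolding r_def by blast
  next
    case False
    then have "card (set P \<inter> {..<n}) + D \<le> length P"
      by (intro card_top_probes) blast
    then have "2 * card (set P \<inter> {..<n}) < m"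
      using P(1) k by linarith
    then obtain t where t: "t < m"
      and gap: "\<And>p. p \<in> set P \<inter> {..<n} \<Longrightarrow> \<not> separates p (rot a t) (rot a (Suc t))"
      using unseparated_gap_exists[OF a, of "set P \<inter> {..<n}"] by blast
    have less: "rot a t < n" "rot a (Suc t) < n"
      using rot_less[OF a] t by simp_all
    have "ddist (G D) p (rot a t) = ddist (G D) p (rot a (Suc t))" if "p \<in> set P" for p
    proof (cases "p < n")
      case True
      then show ?thesis
        using gap[of p] that ddist_top_eq_iff[OF True less] by simp
    next
      case False
      then have "p div n \<noteq> 0" by (simp add: top_iff)
      then have "ddist (G D) p (rot a t) = \<infinity>" "ddist (G D) p (rot a (Suc t)) = \<infinity>"
        using less by (intro ddist_cycle_outside; simp)+
      then show ?thesis by simp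
    qed
    then have "probe (G D) P (rot a t) = probe (G D) P (rot a (Suc t))"
      unfolding probe_eq_iff by blast
    moreover have "rot a t \<noteq> rot a (Suc t)"
      using inj_onD[OF inj_on_rot[OF a], of t "Suc t"] t by auto
    moreover have "rot a (Suc t) \<in> verts (G D)"
      using top_in_V[OF less(2)] by simp
    ultimately show ?thesis
      using move_top[of t] move_top[of "Suc t"] t less(1)
      by (intro bexI[of _ "rot a t"] bexI[of _ "rot a (Suc t)"]) simp_all
  qed
qed

lemma localization_number_G:
  assumes "odd m" "D \<le> (m + 1) div 2"
  shows "\<zeta> (G D) = (m + 1) div 2 + D"
  using cops_win_G[OF assms(1)] not_cops_win_G[OF assms(2)] m_pos
  by (intro localization_number_eqI) auto

lemma localization_number_cycle:
  assumes "0 < i"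
  shows "\<zeta> (rel_digraph (block i) joins) = 1"
proof (rule localization_number_eqI)
  have "cops_win (rel_digraph (block i) joins) (length [i * n])"
  proof (rule wf_digraph.cops_win_in_two_probes[OF wf_rel_digraph refl], goal_cases)
    case 1
    then show ?case using n_gt_2 by simp
  next
    case (2 u)
    have "v = u" if "v \<in> block i" "probe (rel_digraph (block i) joins) [i * n] v =
        probe (rel_digraph (block i) joins) [i * n] u" for v
      using cycle_probe_identifies[OF assms subset_refl that(1)] that(2) by (simp add: probe_def)
    then show ?case by simp
  qed
  then show "cops_win (rel_digraph (block i) joins) 1" by simp
qed simp_all

section \<open>The strong components\<close>

lemma top_reachable:
  assumes u: "u < n" and v: "v < n"
  shows "u \<rightarrow>\<^sup>*\<^bsub>G D\<^esub> v"
proof -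
  interpret wf_digraph "G D" by (rule wf_rel_digraph)
  have arc: "x \<rightarrow>\<^bsub>G D\<^esub> y" if "beats x y" "x < n" "y < n" for x y
    using that by (simp add: top_in_V)
  consider "u = v" | "beats u v" | w where "w < n" "beats u w" "beats w v"
    using beats_two_steps[OF u v] by blast
  then show ?thesis
  proof cases
    case 1
    then show ?thesis using top_in_V[OF v] by simp
  next
    case 2
    show ?thesis by (rule reachable_adjI[OF arc[OF 2 u v]])
  next
    case (3 w)
    show ?thesis
      by (rule reachable_adj_trans[OF reachable_adjI[OF arc[OF 3(2) u 3(1)]] arc[OF 3(3,1) v]])
  qed
qed

lemma scc_of_G:
  assumes "v \<in> V D"
  shows "pre_digraph.scc_of (G D) v = block (v div n)"
proof -
  have "v \<rightarrow>\<^sup>*\<^bsub>G D\<^esub> w \<and> w \<rightarrow>\<^sup>*\<^bsub>G D\<^esub> v \<longleftrightarrow> w div n = v div n" for w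
  proof
    assume "v \<rightarrow>\<^sup>*\<^bsub>G D\<^esub> w \<and> w \<rightarrow>\<^sup>*\<^bsub>G D\<^esub> v"
    then show "w div n = v div n"
      using reachable_block by metis
  next
    assume same: "w div n = v div n"
    show "v \<rightarrow>\<^sup>*\<^bsub>G D\<^esub> w \<and> w \<rightarrow>\<^sup>*\<^bsub>G D\<^esub> v"
    proof (cases "v div n = 0")
      case True
      then show ?thesis using same top_reachable by (simp add: top_iff)
    next
      case False
      then have "0 < v div n" "block (v div n) \<subseteq> V D"
        using assms block_subset_V by (auto simp: V_def)
      then show ?thesis
        using cycle_reachable same by (metis in_block)
    qed
  qed
  then show ?thesis
    by (simp only: pre_digraph.scc_of_def block_def)
qed

definition component :: "nat \<Rightarrow> (nat, nat \<times> nat) pre_digraph" where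
  "component i = rel_digraph (block i) joins"

lemma sccs_G: "pre_digraph.sccs (G D) = component ` {..D}"
proof -
  interpret wf_digraph "G D" by (rule wf_rel_digraph)
  have "sccs = (\<lambda>v. G D \<restriction> scc_of v) ` V D"
    by (simp add: sccs_conv_sccs_verts sccs_verts_conv_scc_of image_image)
  also have "\<dots> = (\<lambda>v. component (v div n)) ` V D"
  proof (rule image_cong[OF refl])
    fix v assume v: "v \<in> V D"
    then have "block (v div n) \<subseteq> V D"
      by (intro block_subset_V) (simp add: V_def)
    then show "G D \<restriction> scc_of v = component (v div n)"
      by (simp add: scc_of_G[OF v] component_def induce_rel_digraph)
  qed
  also have "\<dots> = component ` (\<lambda>v. v div n) ` V D"
    by (simp add: image_image)
  also have "(\<lambda>v. v div n) ` V D = {..D}"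
  proof
    show "{..D} \<subseteq> (\<lambda>v. v div n) ` V D"
    proof
      fix i assume "i \<in> {..D}"
      moreover have "i * n div n = i" using n_gt_2 by simp
      ultimately show "i \<in> (\<lambda>v. v div n) ` V D"
        by (intro image_eqI[of _ _ "i * n"]) (simp_all add: V_def)
    qed
  qed (auto simp: V_def)
  finally show ?thesis .
qed

lemma start_in_block: "i * n \<in> block i"
  using n_gt_2 by simp

lemma inj_component: "inj component"
proof (rule injI)
  fix i j assume "component i = component j"
  then have "verts (component i) = verts (component j)" by simp
  then have "block i = block j" by (simp add: component_def)
  then have "i * n \<in> block j" using start_in_block[of i] by simp
  then show "i = j" using n_gt_2 by simp
qed

lemma SC_G:
  "pverts (SC (G D)) = component ` {..D}"
  "parcs (SC (G D)) = (\<lambda>i. (component 0, component i)) ` {1..D}"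
proof -
  show "pverts (SC (G D)) = component ` {..D}"
    by (simp add: SC_def sccs_G)
  have arc_iff: "(\<exists>u\<in>block i. \<exists>v\<in>block j. u \<rightarrow>\<^bsub>G D\<^esub> v) \<longleftrightarrow> i = 0"
    if "i \<le> D" "j \<le> D" "i \<noteq> j" for i j
  proof
    assume "\<exists>u\<in>block i. \<exists>v\<in>block j. u \<rightarrow>\<^bsub>G D\<^esub> v"
    then obtain u v where uv: "u div n = i" "v div n = j" "joins u v" by auto
    then show "i = 0"
      using joins_block[OF uv(3)] that(3) by simp
  next
    assume "i = 0"
    then have "joins 0 (j * n)" "0 \<in> block i" "j * n \<in> block j" "0 \<in> V D" "j * n \<in> V D"
      using that n_gt_2 start_in_block[of j] by (simp_all add: V_def)
    then show "\<exists>u\<in>block i. \<exists>v\<in>block j. u \<rightarrow>\<^bsub>G D\<^esub> v"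
      by (intro bexI[of _ 0] bexI[of _ "j * n"]) simp_all
  qed
  have "(H, K) \<in> parcs (SC (G D)) \<longleftrightarrow>
      (\<exists>j\<in>{1..D}. H = component 0 \<and> K = component j)" for H K
  proof -
    have "(H, K) \<in> parcs (SC (G D)) \<longleftrightarrow>
      (\<exists>i\<le>D. \<exists>j\<le>D. H = component i \<and> K = component j \<and> component i \<noteq> component j \<and>
        (\<exists>u\<in>verts (component i). \<exists>v\<in>verts (component j). u \<rightarrow>\<^bsub>G D\<^esub> v))"
      unfolding SC_def sccs_G pair_pre_digraph.simps by blast
    also have "\<dots> \<longleftrightarrow> (\<exists>i\<le>D. \<exists>j\<le>D. i \<noteq> j \<and> i = 0 \<and> H = component i \<and> K = component j)"
      using arc_iff inj_component unfolding inj_eq[OF inj_component]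
      unfolding component_def rel_digraph_simps(1) by metis
    also have "\<dots> \<longleftrightarrow> (\<exists>j\<in>{1..D}. H = component 0 \<and> K = component j)"
      unfolding Bex_def atLeastAtMost_iff One_nat_def Suc_le_eq by (metis le0 neq0_conv)
    finally show ?thesis .
  qed
  then show "parcs (SC (G D)) = (\<lambda>i. (component 0, component i)) ` {1..D}"
    unfolding set_eq_iff image_iff split_paired_all prod.inject by simp
qed

lemma max_out_degree_SC_G: "max_out_degree (with_proj (SC (G D))) = D"
proof -
  have out: "out_degree (with_proj (SC (G D))) (component i) = (if i = 0 then D else 0)" for i
  proof -
    have "out_arcs (with_proj (SC (G D))) (component i) =
        (if i = 0 then (\<lambda>j. (component 0, component j)) ` {1..D} else {})"
      by (auto simp: out_arcs_def SC_G inj_eq[OF inj_component])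
    moreover have "inj_on (\<lambda>j. (component 0, component j)) {1..D}"
      by (auto intro!: inj_onI simp: inj_eq[OF inj_component])
    ultimately show ?thesis
      by (simp add: out_degree_def card_image)
  qed
  show ?thesis
    unfolding max_out_degree_def
  proof (rule Max_eqI)
    show "D \<in> out_degree (with_proj (SC (G D))) ` verts (with_proj (SC (G D)))"
      by (rule image_eqI[of _ _ "component 0"]) (simp_all add: out SC_G)
  qed (auto simp: SC_G out)
qed

lemma localization_number_component:
  assumes "odd m"
  shows "\<zeta> (component i) = (if i = 0 then (m + 1) div 2 else 1)"
proof (cases "i = 0")
  case True
  have "component 0 = G 0"
    by (simp add: component_def V_def block_def)
  then show ?thesis
    using localization_number_G[OF assms, of 0] True by simp
next
  case False
  then show ?thesis
    by (simp add: component_def localization_number_cycle)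
qed

lemma oriented_G: "oriented_digraph (G D)"
proof (rule oriented_rel_digraph)
  show "finite (V D)" by (simp add: V_eq)
  show "V D \<noteq> {}" using top_in_V[of 0 D] n_gt_2 by auto
qed (rule joins_asym)

lemma bij_betw_component: "bij_betw (\<lambda>i. component (i - 1)) {1..D + 1} (pre_digraph.sccs (G D))"
proof -
  have "bij_betw (\<lambda>i. i - 1) {1..D + 1} {..D}"
    by (rule bij_betwI[where g = Suc]) auto
  moreover have "bij_betw component {..D} (pre_digraph.sccs (G D))"
    unfolding sccs_G by (rule inj_on_imp_bij_betw[OF inj_on_subset[OF inj_component]]) simp
  ultimately show ?thesis
    by (rule bij_betw_trans[unfolded comp_def])
qed

lemma Max_localization_number_component:
  assumes "odd m"
  shows "Max ((\<lambda>i. \<zeta> (component (i - 1))) ` {1..D + 1}) = (m + 1) div 2"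
proof (rule Max_eqI)
  have "\<zeta> (component (1 - 1)) = (m + 1) div 2"
    using localization_number_component[OF assms, of 0] by simp
  then show "(m + 1) div 2 \<in> (\<lambda>i. \<zeta> (component (i - 1))) ` {1..D + 1}"
    by (intro image_eqI[of _ _ 1]) simp_all
next
  fix z assume "z \<in> (\<lambda>i. \<zeta> (component (i - 1))) ` {1..D + 1}"
  then obtain i where "z = \<zeta> (component i)" by blast
  then show "z \<le> (m + 1) div 2"
    using localization_number_component[OF assms, of i] m_pos by (simp split: if_splits)
qed simp

end

theorem theorem7:
  fixes m \<Delta> :: nat
  assumes "odd m" and "\<Delta> \<le> (m + 1) div 2"
  shows "\<exists>(G :: (nat, nat \<times> nat) pre_digraph) (C :: nat \<Rightarrow> (nat, nat \<times> nat) pre_digraph).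
    oriented_digraph G \<and>
    card (verts G) = (2 * m + 1) * (\<Delta> + 1) \<and>
    bij_betw C {1..\<Delta> + 1} (pre_digraph.sccs G) \<and>
    \<Delta> = max_out_degree (with_proj (SC G)) \<and>
    \<zeta> G = Max ((\<lambda>i. \<zeta> (C i)) ` {1..\<Delta> + 1}) + \<Delta>"
proof -
  interpret tournament_over_cycles m "2 * m + 1"
    by unfold_locales (use \<open>odd m\<close> in \<open>auto elim: oddE\<close>)
  show ?thesis
  proof (intro exI conjI)
    show "oriented_digraph (G \<Delta>)"
      by (rule oriented_G)
    show "card (verts (G \<Delta>)) = (2 * m + 1) * (\<Delta> + 1)"
      unfolding rel_digraph_simps V_eq by (rule card_lessThan)
    show "bij_betw (\<lambda>i. component (i - 1)) {1..\<Delta> + 1} (pre_digraph.sccs (G \<Delta>))"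
      by (rule bij_betw_component)
    show "\<Delta> = max_out_degree (with_proj (SC (G \<Delta>)))"
      by (rule max_out_degree_SC_G[symmetric])
    show "\<zeta> (G \<Delta>) = Max ((\<lambda>i. \<zeta> (component (i - 1))) ` {1..\<Delta> + 1}) + \<Delta>"
      unfolding localization_number_G[OF assms] Max_localization_number_component[OF assms(1)] ..
  qed
qed

end
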